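(* Let $\Gamma$ be a finite group with no non-trivial representation of dimension less than $k$ (where $k>0$), let $n=|\Gamma|$, and let $A$, $B$ and $C$ be three subsets of $\Gamma$ such that $|A||B||C|>n^3/k$. Then there exist $a\in A$, $b\in B$ and $c\in C$ with $ab=c$. In particular, this is true if all of $A$, $B$ and $C$ have size greater than $n/k^{1/3}$. Furthermore, if $\eta>0$ and $A,B,C\subset\Gamma$ satisfy $|A||B||C|\geq n^3/(\eta^2k)$, then the number of triples $(a,b,c)\in A\times B\times C$ such that $ab=c$ is at least $(1-\eta)|A||B||C|/n$.
   Context: Representations are finite-dimensional complex representations. A representation is non-trivial if at least one group element acts as something other than the identity map. *)

theory Defs
  imports Complex_Main "HOL-Algebra.Group" "Jordan_Normal_Form.Matrix"
begin

text \<open>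
  A complex representation of dimension \<open>m\<close> is taken in matrix form, that is, after a choice of
  basis of the underlying space. The group \<open>GL\<^sub>m(\<complex>)\<close> is the unit group of the matrix ring;
  the argument \<open>()\<close> of \<^const>\<open>ring_mat\<close> only fills the record extension slot.
\<close>

abbreviation GL :: "nat \<Rightarrow> complex mat monoid" where
  "GL m \<equiv> units_of (ring_mat TYPE(complex) m ())"

definition representation ::
    "('a, 'b) monoid_scheme \<Rightarrow> nat \<Rightarrow> ('a \<Rightarrow> complex mat) \<Rightarrow> bool" where
  "representation G m \<rho> \<longleftrightarrow> \<rho> \<in> hom G (GL m)"

definition nontrivial_representation ::
    "('a, 'b) monoid_scheme \<Rightarrow> nat \<Rightarrow> ('a \<Rightarrow> complex mat) \<Rightarrow> bool" where
  "nontrivial_representation G m \<rho> \<longleftrightarrow>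
     representation G m \<rho> \<and> (\<exists>g\<in>carrier G. \<rho> g \<noteq> 1\<^sub>m m)"

lemma representation_iff:
  assumes "group G"
  shows "representation G m \<rho> \<longleftrightarrow>
    (\<forall>g\<in>carrier G. \<rho> g \<in> carrier_mat m m) \<and> \<rho> \<one>\<^bsub>G\<^esub> = 1\<^sub>m m \<and>
    (\<forall>g\<in>carrier G. \<forall>h\<in>carrier G. \<rho> (g \<otimes>\<^bsub>G\<^esub> h) = \<rho> g * \<rho> h)"
    (is "_ \<longleftrightarrow> ?R")
proof
  interpret G: group G by fact
  interpret M: ring "ring_mat TYPE(complex) m ()" by (rule ring_mat)
  {
    assume "representation G m \<rho>"
    then have r: "\<rho> \<in> hom G (GL m)" by (simp add: representation_def)
    have "\<rho> \<one>\<^bsub>G\<^esub> = 1\<^sub>m m"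
      using hom_one[OF r assms M.units_group] by (simp add: units_of_one ring_mat_simps)
    with r show ?R
      by (auto simp: hom_def Pi_iff units_of_carrier units_of_mult Units_def ring_mat_simps)
  next
    assume R: ?R
    have "\<rho> g \<in> Units (ring_mat TYPE(complex) m ())" if g: "g \<in> carrier G" for g
    proof -
      have "\<rho> g * \<rho> (inv\<^bsub>G\<^esub> g) = 1\<^sub>m m" "\<rho> (inv\<^bsub>G\<^esub> g) * \<rho> g = 1\<^sub>m m"
        using R g by (metis G.inv_closed G.r_inv) (metis R g G.inv_closed G.l_inv)
      then show ?thesis
        using R g by (auto simp: Units_def ring_mat_simps intro!: bexI[of _ "\<rho> (inv\<^bsub>G\<^esub> g)"])
    qed
    with R show "representation G m \<rho>"
      by (auto simp: representation_def hom_def units_of_carrier units_of_mult ring_mat_simps)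
  }
qed

end

theory Submission
  imports Defs "HOL-Analysis.Convex" "HOL-Analysis.Elementary_Metric_Spaces"
begin

text \<open>
  Let \<open>K x y\<close> be the indicator of \<open>x y\<^sup>-\<^sup>1 \<in> A\<close>, regarded as an operator on real functions on the
  group. The number of triples is \<open>\<langle>1\<^sub>C, K 1\<^sub>B\<rangle>\<close>; splitting off the mean of \<open>1\<^sub>B\<close> gives the main term
  \<open>|A||B||C|/n\<close>, and the error is controlled by the norm of \<open>K\<close> on mean-zero functions. Since \<open>K\<close>
  commutes with right translations, the top eigenspace of \<open>K\<^sup>T K\<close> on mean-zero functions is a
  representation, non-trivial because only constants are translation invariant. Its dimension is
  therefore at least \<open>k\<close>, so the trace \<open>n|A|\<close> of \<open>K\<^sup>T K\<close> is at least \<open>k\<close> times the eigenvalue.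
\<close>

section \<open>Inner products, orthonormal families and kernel operators on a finite set\<close>

definition ip :: "'a set \<Rightarrow> ('a \<Rightarrow> real) \<Rightarrow> ('a \<Rightarrow> real) \<Rightarrow> real" where
  "ip X f g = (\<Sum>x\<in>X. f x * g x)"

definition kernel_op :: "'a set \<Rightarrow> ('a \<Rightarrow> 'a \<Rightarrow> real) \<Rightarrow> ('a \<Rightarrow> real) \<Rightarrow> 'a \<Rightarrow> real" where
  "kernel_op X K f x = (\<Sum>y\<in>X. K x y * f y)"

definition orthonormal :: "'a set \<Rightarrow> nat \<Rightarrow> (nat \<Rightarrow> 'a \<Rightarrow> real) \<Rightarrow> bool" where
  "orthonormal X d e \<longleftrightarrow> (\<forall>i<d. \<forall>j<d. ip X (e i) (e j) = (if i = j then 1 else 0))"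

lemma ip_commute: "ip X f g = ip X g f"
  by (simp add: ip_def mult.commute)

lemma ip_cong: "(\<And>x. x \<in> X \<Longrightarrow> f x = f' x) \<Longrightarrow> (\<And>x. x \<in> X \<Longrightarrow> g x = g' x) \<Longrightarrow> ip X f g = ip X f' g'"
  by (simp add: ip_def)

lemma ip_lincomb_left: "ip X (\<lambda>x. a * f x + b * g x) h = a * ip X f h + b * ip X g h"
  by (simp add: ip_def algebra_simps sum.distrib sum_distrib_left)

lemma ip_scale_left: "ip X (\<lambda>x. a * f x) h = a * ip X f h"
  by (simp add: ip_def algebra_simps sum_distrib_left)

lemma ip_scale_right: "ip X f (\<lambda>x. a * h x) = a * ip X f h"
  by (simp add: ip_def algebra_simps sum_distrib_left)

lemma ip_sum_left: "ip X (\<lambda>x. \<Sum>j\<in>J. c j * f j x) h = (\<Sum>j\<in>J. c j * ip X (f j) h)"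
  unfolding ip_def by (simp add: sum_distrib_left sum_distrib_right mult.assoc) (rule sum.swap)

lemma ip_self_nonneg [simp]: "0 \<le> ip X f f"
  by (simp add: ip_def sum_nonneg)

lemma ip_self_eq_0_iff: "finite X \<Longrightarrow> ip X f f = 0 \<longleftrightarrow> (\<forall>x\<in>X. f x = 0)"
  by (simp add: ip_def sum_nonneg_eq_0_iff)

lemma ip_cauchy_schwarz: "(ip X f g)\<^sup>2 \<le> ip X f f * ip X g g"
  using Cauchy_Schwarz_ineq_sum[of f g X] by (simp add: ip_def power2_eq_square)

lemma kernel_op_lincomb:
  "kernel_op X K (\<lambda>x. a * f x + b * g x) = (\<lambda>x. a * kernel_op X K f x + b * kernel_op X K g x)"
  by (simp add: kernel_op_def algebra_simps sum.distrib sum_distrib_left fun_eq_iff)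

lemma kernel_op_scale: "kernel_op X K (\<lambda>x. a * f x) = (\<lambda>x. a * kernel_op X K f x)"
  by (simp add: kernel_op_def algebra_simps sum_distrib_left fun_eq_iff)

text \<open>Pairing the projection with \<open>e i\<close> leaves only the coefficient of
  \<open>e i\<close>. The residual is written with factors \<open>1\<close> and \<open>- 1\<close>
  so that the lemmas on linear combinations match it literally.\<close>

lemma ip_residual:
  assumes "orthonormal X d e" "i < d"
  shows "ip X (\<lambda>x. 1 * f x + (- 1) * (\<Sum>j<d. ip X f (e j) * e j x)) (e i) = 0"
proof -
  have "ip X (\<lambda>x. \<Sum>j<d. ip X f (e j) * e j x) (e i) = (\<Sum>j<d. if j = i then ip X f (e j) else 0)"
    unfolding ip_sum_left using assms by (intro sum.cong) (auto simp: orthonormal_def)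
  then show ?thesis
    using assms(2) by (simp only: ip_lincomb_left) simp
qed

text \<open>The residual \<open>r\<close> is orthogonal to the projection \<open>p\<close>, so
  \<open>ip X f f - ip X p f\<close> is the squared norm of \<open>r\<close>, while
  \<open>ip X p f\<close> is the sum of the squared coefficients.\<close>

lemma bessel:
  assumes "orthonormal X d e"
  shows "(\<Sum>j<d. (ip X f (e j))\<^sup>2) \<le> ip X f f"
proof -
  define p where "p = (\<lambda>x. \<Sum>j<d. ip X f (e j) * e j x)"
  define r where "r = (\<lambda>x. 1 * f x + (- 1) * p x)"
  have "ip X r (e i) = 0" if "i < d" for i
    using ip_residual[OF assms that, of f] unfolding r_def p_def .
  then have "ip X p r = 0"
    unfolding p_def ip_sum_left by (simp add: ip_commute[of X _ r])
  then have 1: "ip X f r = ip X r r"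
    using ip_lincomb_left[of X 1 f "-1" p r] by (simp add: r_def)
  have "ip X p f = (\<Sum>j<d. (ip X f (e j))\<^sup>2)"
    unfolding p_def ip_sum_left by (simp add: ip_commute[of X _ f] power2_eq_square)
  moreover have "ip X f r = ip X f f - ip X p f"
    using ip_lincomb_left[of X 1 f "-1" p f, folded r_def] ip_commute[of X f r] by simp
  ultimately show ?thesis
    using 1 ip_self_nonneg[of X r] by linarith
qed

text \<open>Bessel's inequality for the point mass at \<open>x\<close> bounds the sum of the
  \<open>(e j x)\<^sup>2\<close> over \<open>j\<close> by 1. Summing over \<open>x\<close> instead
  counts the unit norms. This a priori bound makes a longest orthonormal family available.\<close>

lemma orthonormal_card_le:
  assumes "finite X" "orthonormal X d e"
  shows "d \<le> card X"
proof -
  have ind: "ip X (\<lambda>y. of_bool (y = x)) h = h x" if "x \<in> X" for x h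
    using assms(1) that by (simp add: ip_def of_bool_def if_distrib[of "\<lambda>u. u * _"] sum.delta cong: if_cong)
  have "real d = (\<Sum>j<d. ip X (e j) (e j))"
    using assms(2) by (simp add: orthonormal_def)
  also have "\<dots> = (\<Sum>j<d. \<Sum>x\<in>X. (e j x)\<^sup>2)"
    by (simp add: ip_def power2_eq_square)
  also have "\<dots> = (\<Sum>x\<in>X. \<Sum>j<d. (e j x)\<^sup>2)"
    by (rule sum.swap)
  also have "\<dots> \<le> (\<Sum>x\<in>X. 1)"
  proof (rule sum_mono)
    fix x assume x: "x \<in> X"
    show "(\<Sum>j<d. (e j x)\<^sup>2) \<le> 1"
      using bessel[OF assms(2), of "\<lambda>y. of_bool (y = x)"] by (simp add: ind[OF x])
  qed
  finally show ?thesis by simp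
qed

text \<open>An orthonormal family in \<open>W\<close> of greatest length spans: a nonzero residual,
  once normalised, would extend it. The expansion is claimed on \<open>X\<close> only, since
  \<open>ip\<close> does not see other values.\<close>

lemma orthonormal_basis_exists:
  assumes fin: "finite X"
    and lin: "\<And>f g a b. f \<in> W \<Longrightarrow> g \<in> W \<Longrightarrow> (\<lambda>x. a * f x + b * g x) \<in> W"
    and zero: "(\<lambda>x. 0) \<in> W"
  obtains d e where "orthonormal X d e" "\<And>i. i < d \<Longrightarrow> e i \<in> W"
    "\<And>f x. f \<in> W \<Longrightarrow> x \<in> X \<Longrightarrow> f x = (\<Sum>j<d. ip X f (e j) * e j x)"
proof -
  define P where "P d \<longleftrightarrow> (\<exists>e. orthonormal X d e \<and> (\<forall>i<d. e i \<in> W))" for d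
  have "P 0" by (simp add: P_def orthonormal_def)
  moreover have "\<forall>d. P d \<longrightarrow> d \<le> card X"
    using orthonormal_card_le[OF fin] by (auto simp: P_def)
  ultimately obtain d where "P d" and max: "\<forall>d'. P d' \<longrightarrow> d' \<le> d"
    using Nat.ex_has_greatest_nat[of P 0 "card X"] by blast
  then obtain e where e: "orthonormal X d e" and eW: "\<And>i. i < d \<Longrightarrow> e i \<in> W"
    by (auto simp: P_def)
  have sumW: "(\<lambda>x. \<Sum>j<m. c j * e j x) \<in> W" if "m \<le> d" for m c
    using that
  proof (induction m)
    case 0
    show ?case by (simp add: zero)
  next
    case (Suc m)
    then show ?case
      using lin[of "\<lambda>x. \<Sum>j<m. c j * e j x" "e m" 1 "c m"] eW by simp
  qed
  have "f x = (\<Sum>j<d. ip X f (e j) * e j x)" if f: "f \<in> W" and x: "x \<in> X" for f x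
  proof (rule ccontr)
    assume neq: "f x \<noteq> (\<Sum>j<d. ip X f (e j) * e j x)"
    define r where "r = (\<lambda>x. 1 * f x + (- 1) * (\<Sum>j<d. ip X f (e j) * e j x))"
    have rW: "r \<in> W"
      unfolding r_def by (intro lin f sumW) simp
    have "ip X r r \<noteq> 0"
      using neq x fin by (auto simp: ip_self_eq_0_iff r_def)
    then have pos: "ip X r r > 0"
      using ip_self_nonneg[of X r] by linarith
    \<comment> \<open>The idle summand \<open>0 * r x\<close> gives the normalised residual the
      shape required by \<open>lin\<close> and \<open>ip_lincomb_left\<close>.\<close>
    define u where "u = (\<lambda>x. (1 / sqrt (ip X r r)) * r x + 0 * r x)"
    have uip: "ip X u h = ip X r h / sqrt (ip X r r)" for h
      unfolding u_def ip_lincomb_left by simp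
    have uu: "ip X u u = 1"
      using pos by (simp add: uip ip_commute[of X r u])
    have ue: "ip X u (e i) = 0" "ip X (e i) u = 0" if "i < d" for i
      using ip_residual[OF e that, of f, folded r_def] by (simp_all add: uip ip_commute[of X "e i" u])
    have "u \<in> W" unfolding u_def by (intro lin rW)
    moreover have "orthonormal X (Suc d) (e(d := u))"
      using e uu ue by (auto simp: orthonormal_def less_Suc_eq)
    ultimately have "P (Suc d)"
      unfolding P_def using eW by (intro exI[of _ "e(d := u)"]) (auto simp: less_Suc_eq)
    then show False using max by fastforce
  qed
  with e eW show thesis using that by blast
qed

section \<open>Maximisation on the unit sphere and the top eigenspace\<close>

lemma attains_max_pointwise:
  fixes \<phi> :: "('a \<Rightarrow> real) \<Rightarrow> real"
  assumes fin: "finite X" and ne: "S \<noteq> {}"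
    and bnd: "\<And>f x. f \<in> S \<Longrightarrow> x \<in> X \<Longrightarrow> \<bar>f x\<bar> \<le> B"
    and clos: "\<And>s l. (\<And>n. s n \<in> S) \<Longrightarrow> (\<And>x. x \<in> X \<Longrightarrow> (\<lambda>n::nat. s n x) \<longlonglongrightarrow> l x) \<Longrightarrow> l \<in> S"
    and cont: "\<And>s l. (\<And>x. x \<in> X \<Longrightarrow> (\<lambda>n::nat. s n x) \<longlonglongrightarrow> l x) \<Longrightarrow> (\<lambda>n. \<phi> (s n)) \<longlonglongrightarrow> \<phi> l"
  obtains f where "f \<in> S" "\<And>g. g \<in> S \<Longrightarrow> \<phi> g \<le> \<phi> f"
proof -
  \<comment> \<open>Compactness is proved for the set of values in the reals, so only pointwise
    convergence on \<open>X\<close> of the functions themselves enters. The limit \<open>l\<close>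
    is arbitrary off \<open>X\<close>, which is why \<open>clos\<close> and \<open>cont\<close>
    constrain it on \<open>X\<close> alone.\<close>
  have "seq_compact (\<phi> ` S)"
  proof (rule seq_compactI)
    fix y :: "nat \<Rightarrow> real" assume "\<forall>n. y n \<in> \<phi> ` S"
    then have "\<forall>n. \<exists>f. f \<in> S \<and> y n = \<phi> f" by blast
    then obtain s where s: "\<And>n. s n \<in> S" "\<And>n. y n = \<phi> (s n)" by metis
    have "bounded ((\<lambda>f. f x) ` range s)" if "x \<in> X" for x
      using bnd[OF s(1) that] by (auto simp: bounded_iff)
    \<comment> \<open>Finiteness of \<open>X\<close> yields one subsequence that converges at all
      points of \<open>X\<close> simultaneously.\<close>
    then obtain l r where r: "strict_mono (r :: nat \<Rightarrow> nat)"
      and ev: "\<And>\<epsilon>. \<epsilon> > 0 \<Longrightarrow> eventually (\<lambda>n. \<forall>x\<in>X. dist (s (r n) x) (l x) < \<epsilon>) sequentially"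
      using compact_lemma_general[of X "\<lambda>f x. f x" s "\<lambda>f. f", rule_format, OF fin _ _ _ order_refl]
      by blast
    have lim: "(\<lambda>n. (s \<circ> r) n x) \<longlonglongrightarrow> l x" if "x \<in> X" for x
      unfolding tendsto_iff
    proof (intro allI impI)
      fix \<epsilon> :: real assume "\<epsilon> > 0"
      from ev[OF this] show "\<forall>\<^sub>F n in sequentially. dist ((s \<circ> r) n x) (l x) < \<epsilon>"
        by eventually_elim (use that in auto)
    qed
    have "l \<in> S"
      using clos[of "s \<circ> r" l] s lim by auto
    moreover have "(y \<circ> r) \<longlonglongrightarrow> \<phi> l"
      using cont[OF lim] by (simp add: comp_def s)
    ultimately show "\<exists>l\<in>\<phi> ` S. \<exists>r. strict_mono r \<and> (y \<circ> r) \<longlonglongrightarrow> l"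
      using r by blast
  qed
  then have "compact (\<phi> ` S)"
    by (simp add: compact_eq_seq_compact_metric)
  then obtain m where "m \<in> \<phi> ` S" "\<forall>t\<in>\<phi> ` S. t \<le> m"
    using compact_attains_sup[of "\<phi> ` S"] ne by auto
  then show thesis using that by blast
qed

text \<open>
  If \<open>\<lambda>\<close> is the largest value of \<open>\<parallel>K f\<parallel>\<^sup>2\<close> on the unit sphere of the mean-zero functions, the
  form \<open>\<lambda>\<langle>f, g\<rangle> - \<langle>K f, K g\<rangle>\<close> is positive semidefinite there, so its isotropic vectors form a
  subspace: the top eigenspace of \<open>K\<^sup>T K\<close>.
\<close>

definition defect :: "'a set \<Rightarrow> ('a \<Rightarrow> 'a \<Rightarrow> real) \<Rightarrow> real \<Rightarrow> ('a \<Rightarrow> real) \<Rightarrow> ('a \<Rightarrow> real) \<Rightarrow> real" where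
  "defect X K l f g = l * ip X f g - ip X (kernel_op X K f) (kernel_op X K g)"

lemma defect_lincomb_left:
  "defect X K l (\<lambda>x. a * f x + b * g x) h = a * defect X K l f h + b * defect X K l g h"
  by (simp add: defect_def kernel_op_lincomb ip_lincomb_left algebra_simps)

lemma defect_commute: "defect X K l f g = defect X K l g f"
  by (simp add: defect_def ip_commute)

lemma defect_lincomb_self:
  "defect X K l (\<lambda>x. a * f x + b * g x) (\<lambda>x. a * f x + b * g x)
     = a\<^sup>2 * defect X K l f f + 2 * a * b * defect X K l f g + b\<^sup>2 * defect X K l g g"
proof -
  have r: "defect X K l h (\<lambda>x. a * f x + b * g x) = a * defect X K l f h + b * defect X K l g h" for h
    using defect_lincomb_left[of X K l a f b g h] by (simp add: defect_commute)
  show ?thesis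
    unfolding defect_lincomb_left r
    by (simp add: defect_commute[of X K l g f] algebra_simps power2_eq_square)
qed

text \<open>For isotropic \<open>f\<close> the form on \<open>a f + g\<close> is affine in
  \<open>a\<close> with slope \<open>2 * defect X K l f g\<close>; an affine function bounded below
  has slope 0.\<close>

lemma isotropic_orthogonal:
  assumes "\<And>a b. defect X K l (\<lambda>x. a * f x + b * g x) (\<lambda>x. a * f x + b * g x) \<ge> 0"
    and "defect X K l f f = 0"
  shows "defect X K l f g = 0"
proof (rule ccontr)
  let ?c = "defect X K l f g" and ?q = "defect X K l g g"
  assume c: "?c \<noteq> 0"
  \<comment> \<open>The coefficient of \<open>f\<close> is chosen to make the form equal to
    -1.\<close>
  have "0 \<le> 2 * (- (?q + 1) / (2 * ?c)) * 1 * ?c + 1\<^sup>2 * ?q"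
    using assms(1)[of "- (?q + 1) / (2 * ?c)" 1] assms(2) unfolding defect_lincomb_self by simp
  also have "\<dots> = -1" using c by (simp add: field_simps)
  finally show False by simp
qed

text \<open>Here \<open>l\<close> is the maximum of the squared norm of \<open>K f\<close> over
  mean-zero unit vectors, attained by compactness. The vector \<open>f0\<close> only witnesses that
  this sphere is nonempty, and homogeneity carries the bound from the sphere to all mean-zero
  functions.\<close>

lemma exists_top_value:
  assumes fin: "finite X" and f0: "ip X f0 f0 \<noteq> 0" "sum f0 X = 0"
  obtains l f where "sum f X = 0" "ip X f f = 1" "defect X K l f f = 0"
    "\<And>g. sum g X = 0 \<Longrightarrow> defect X K l g g \<ge> 0"
proof -
  define S where "S = {f. sum f X = 0 \<and> ip X f f = 1}"
  define \<phi> where "\<phi> f = ip X (kernel_op X K f) (kernel_op X K f)" for f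
  have normal: "(\<lambda>x. (1 / sqrt (ip X g g)) * g x) \<in> S" if g: "ip X g g \<noteq> 0" "sum g X = 0" for g
  proof -
    have "ip X g g > 0" using g(1) ip_self_nonneg[of X g] by linarith
    then have "ip X (\<lambda>x. (1 / sqrt (ip X g g)) * g x) (\<lambda>x. (1 / sqrt (ip X g g)) * g x) = 1"
      unfolding ip_scale_left ip_scale_right by (simp add: field_simps flip: power2_eq_square)
    moreover have "(\<Sum>x\<in>X. (1 / sqrt (ip X g g)) * g x) = 0"
      using g(2) by (simp only: sum_distrib_left[symmetric] mult_zero_right)
    ultimately show ?thesis by (simp add: S_def)
  qed
  obtain f where f: "f \<in> S" and max: "\<And>g. g \<in> S \<Longrightarrow> \<phi> g \<le> \<phi> f"
  proof (rule attains_max_pointwise[OF fin, of S 1 \<phi>])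
    show "S \<noteq> {}" using normal[OF f0] by blast
  next
    fix f x assume "f \<in> S" "x \<in> X"
    then have "(f x)\<^sup>2 \<le> 1"
      using fin member_le_sum[of x X "\<lambda>x. (f x)\<^sup>2"] by (auto simp: S_def ip_def power2_eq_square)
    then show "\<bar>f x\<bar> \<le> 1" by (simp add: abs_square_le_1)
  next
    fix s :: "nat \<Rightarrow> 'a \<Rightarrow> real" and l
    assume s: "\<And>n. s n \<in> S" and lim: "\<And>x. x \<in> X \<Longrightarrow> (\<lambda>n. s n x) \<longlonglongrightarrow> l x"
    have "(\<lambda>n. sum (s n) X) \<longlonglongrightarrow> sum l X" "(\<lambda>n. ip X (s n) (s n)) \<longlonglongrightarrow> ip X l l"
      unfolding ip_def by (intro tendsto_sum tendsto_mult lim; assumption)+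
    then show "l \<in> S"
      using s by (simp add: S_def LIMSEQ_const_iff)
  next
    fix s :: "nat \<Rightarrow> 'a \<Rightarrow> real" and l
    assume lim: "\<And>x. x \<in> X \<Longrightarrow> (\<lambda>n. s n x) \<longlonglongrightarrow> l x"
    show "(\<lambda>n. \<phi> (s n)) \<longlonglongrightarrow> \<phi> l"
      unfolding \<phi>_def ip_def kernel_op_def by (intro tendsto_intros lim)
  qed blast
  have "defect X K (\<phi> f) g g \<ge> 0" if g: "sum g X = 0" for g
  proof (cases "ip X g g = 0")
    case True
    then have "\<forall>x\<in>X. g x = 0" using fin by (simp add: ip_self_eq_0_iff)
    then have "kernel_op X K g = (\<lambda>x. 0)" by (simp add: kernel_op_def fun_eq_iff)
    then show ?thesis using True by (simp add: defect_def ip_def)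
  next
    case False
    then have pos: "ip X g g > 0" using ip_self_nonneg[of X g] by linarith
    have "\<phi> (\<lambda>x. (1 / sqrt (ip X g g)) * g x) = \<phi> g / ip X g g"
      unfolding \<phi>_def kernel_op_scale ip_scale_left ip_scale_right
      using pos by (simp flip: power2_eq_square)
    then have "\<phi> g / ip X g g \<le> \<phi> f"
      using max[OF normal[OF False g]] by simp
    then show ?thesis
      using pos by (simp add: defect_def \<phi>_def field_simps)
  qed
  moreover have "defect X K (\<phi> f) f f = 0"
    using f by (auto simp: \<phi>_def defect_def S_def)
  ultimately show thesis using that f by (auto simp: S_def)
qed

section \<open>Right translations and the representations they induce\<close>

context group
begin

lemma sum_translate_right:
  assumes "g \<in> carrier G"
  shows "(\<Sum>x\<in>carrier G. F (x \<otimes> g)) = sum F (carrier G)"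
  by (rule sum.reindex_bij_witness[of _ "\<lambda>x. x \<otimes> inv g" "\<lambda>x. x \<otimes> g"])
    (use assms in \<open>auto simp: m_assoc\<close>)

lemma ip_translate_right:
  assumes "g \<in> carrier G"
  shows "ip (carrier G) (\<lambda>x. f (x \<otimes> g)) (\<lambda>x. h (x \<otimes> g)) = ip (carrier G) f h"
  unfolding ip_def by (rule sum_translate_right[OF assms])

lemma kernel_op_translate_right:
  assumes inv: "\<And>x y g. x \<in> carrier G \<Longrightarrow> y \<in> carrier G \<Longrightarrow> g \<in> carrier G \<Longrightarrow> K (x \<otimes> g) (y \<otimes> g) = K x y"
    and "g \<in> carrier G" "x \<in> carrier G"
  shows "kernel_op (carrier G) K (\<lambda>x. f (x \<otimes> g)) x = kernel_op (carrier G) K f (x \<otimes> g)"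
  unfolding kernel_op_def sum_translate_right[OF assms(2), symmetric, of "\<lambda>y. K (x \<otimes> g) y * f y"]
  using assms by (intro sum.cong) auto

text \<open>These are the matrices, in the basis \<open>e\<close>, of the translations sending
  \<open>f\<close> to \<open>\<lambda>x. f (x \<otimes> g)\<close>; column \<open>j\<close> holds
  the coefficients of the translate of \<open>e j\<close>. Translating on the right by
  \<open>g\<close> itself preserves the order of products, so no inverse occurs.\<close>

lemma representation_of_invariant_family:
  assumes on: "orthonormal (carrier G) d e"
    and inv: "\<And>g j x. g \<in> carrier G \<Longrightarrow> j < d \<Longrightarrow> x \<in> carrier G \<Longrightarrow>
      e j (x \<otimes> g) = (\<Sum>i<d. ip (carrier G) (\<lambda>x. e j (x \<otimes> g)) (e i) * e i x)"
  shows "representation G d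
    (\<lambda>g. mat d d (\<lambda>(i, j). complex_of_real (ip (carrier G) (\<lambda>x. e j (x \<otimes> g)) (e i))))"
proof -
  let ?ip = "ip (carrier G)"
  have one: "?ip (\<lambda>x. e j (x \<otimes> \<one>)) (e i) = ?ip (e j) (e i)" for i j
    by (rule ip_cong) auto
  have mult: "?ip (\<lambda>x. e j (x \<otimes> (g \<otimes> h))) (e i)
      = (\<Sum>l<d. ?ip (\<lambda>x. e l (x \<otimes> g)) (e i) * ?ip (\<lambda>x. e j (x \<otimes> h)) (e l))"
    if g: "g \<in> carrier G" and h: "h \<in> carrier G" and j: "j < d" for g h i j
  proof -
    \<comment> \<open>Expand the translate of \<open>e j\<close> by \<open>h\<close> and evaluate at
      \<open>x \<otimes> g\<close>.\<close>
    have "?ip (\<lambda>x. e j (x \<otimes> (g \<otimes> h))) (e i)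
        = ?ip (\<lambda>x. \<Sum>l<d. ?ip (\<lambda>x. e j (x \<otimes> h)) (e l) * e l (x \<otimes> g)) (e i)"
    proof (rule ip_cong)
      fix x assume x: "x \<in> carrier G"
      have "e j (x \<otimes> (g \<otimes> h)) = e j ((x \<otimes> g) \<otimes> h)"
        using x g h by (simp add: m_assoc)
      also have "\<dots> = (\<Sum>l<d. ?ip (\<lambda>x. e j (x \<otimes> h)) (e l) * e l (x \<otimes> g))"
        by (rule inv) (use x g h j in auto)
      finally show "e j (x \<otimes> (g \<otimes> h)) = \<dots>" .
    qed simp
    also have "\<dots> = (\<Sum>l<d. ?ip (\<lambda>x. e l (x \<otimes> g)) (e i) * ?ip (\<lambda>x. e j (x \<otimes> h)) (e l))"
      unfolding ip_sum_left by (simp add: mult.commute)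
    finally show ?thesis .
  qed
  show ?thesis
    unfolding representation_iff[OF is_group]
  proof (intro conjI ballI)
    show "mat d d (\<lambda>(i, j). complex_of_real (?ip (\<lambda>x. e j (x \<otimes> \<one>)) (e i))) = 1\<^sub>m d"
      using on by (intro eq_matI) (auto simp: one orthonormal_def)
  next
    fix g h assume gh: "g \<in> carrier G" "h \<in> carrier G"
    show "mat d d (\<lambda>(i, j). complex_of_real (?ip (\<lambda>x. e j (x \<otimes> (g \<otimes> h))) (e i)))
      = mat d d (\<lambda>(i, j). complex_of_real (?ip (\<lambda>x. e j (x \<otimes> g)) (e i)))
        * mat d d (\<lambda>(i, j). complex_of_real (?ip (\<lambda>x. e j (x \<otimes> h)) (e i)))"
      by (intro eq_matI) (auto simp: mult[OF gh] scalar_prod_def atLeast0LessThan)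
  qed simp
qed

text \<open>If every matrix were the identity, \<open>e 0\<close> would be translation invariant,
  hence constant, and by mean zero orthogonal to itself, against its norm being 1.\<close>

lemma nontrivial_representation_of_mean_zero_family:
  assumes on: "orthonormal (carrier G) d e" and "d > 0"
    and inv: "\<And>g j x. g \<in> carrier G \<Longrightarrow> j < d \<Longrightarrow> x \<in> carrier G \<Longrightarrow>
      e j (x \<otimes> g) = (\<Sum>i<d. ip (carrier G) (\<lambda>x. e j (x \<otimes> g)) (e i) * e i x)"
    and zero: "sum (e 0) (carrier G) = 0"
  shows "\<exists>\<rho>. nontrivial_representation G d \<rho>"
proof -
  let ?ip = "ip (carrier G)"
  let ?\<rho> = "\<lambda>g. mat d d (\<lambda>(i, j). complex_of_real (?ip (\<lambda>x. e j (x \<otimes> g)) (e i)))"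
  have "\<exists>g\<in>carrier G. ?\<rho> g \<noteq> 1\<^sub>m d"
  proof (rule ccontr)
    assume "\<not> ?thesis"
    then have triv: "?\<rho> g = 1\<^sub>m d" if "g \<in> carrier G" for g using that by blast
    have "e 0 g = e 0 \<one>" if g: "g \<in> carrier G" for g
    proof -
      have "?ip (\<lambda>x. e 0 (x \<otimes> g)) (e i) = (if i = 0 then 1 else 0)" if "i < d" for i
      proof -
        have "complex_of_real (?ip (\<lambda>x. e 0 (x \<otimes> g)) (e i)) = ?\<rho> g $$ (i, 0)"
          using that \<open>d > 0\<close> by simp
        also have "\<dots> = (if i = 0 then 1 else 0)"
          unfolding triv[OF g] using that \<open>d > 0\<close> by simp
        finally show ?thesis by (simp split: if_splits)
      qed
      \<comment> \<open>Evaluating the expansion of the translate at the identity reads off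
        \<open>e 0 g\<close>.\<close>
      then have "e 0 (\<one> \<otimes> g) = (\<Sum>i<d. if i = 0 then e i \<one> else 0)"
        unfolding inv[OF g \<open>d > 0\<close> one_closed] by (intro sum.cong) auto
      then show ?thesis using g \<open>d > 0\<close> by simp
    qed
    then have const: "e 0 g = e 0 \<one>" if "g \<in> carrier G" for g using that by blast
    have "?ip (e 0) (e 0) = (\<Sum>x\<in>carrier G. e 0 \<one> * e 0 x)"
      unfolding ip_def by (rule sum.cong) (auto dest: const)
    also have "\<dots> = 0" unfolding sum_distrib_left[symmetric] zero by simp
    finally show False using on \<open>d > 0\<close> by (simp add: orthonormal_def)
  qed
  then show ?thesis
    using representation_of_invariant_family[OF on inv] by (auto simp: nontrivial_representation_def)
qed

text \<open>The sum on the right is the squared Hilbert-Schmidt norm of \<open>K\<close>, that is,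
  the trace of \<open>K\<^sup>T K\<close>. It dominates \<open>d * l\<close>, where \<open>l\<close>
  is the top eigenvalue on mean-zero functions and \<open>d\<close>, the dimension of its eigenspace
  \<open>W\<close>, is at least \<open>k\<close>.\<close>

lemma invariant_kernel_bound:
  fixes k :: real
  assumes fin: "finite (carrier G)"
    and norep: "\<not> (\<exists>m \<rho>. real m < k \<and> nontrivial_representation G m \<rho>)"
    and Kinv: "\<And>x y g. x \<in> carrier G \<Longrightarrow> y \<in> carrier G \<Longrightarrow> g \<in> carrier G \<Longrightarrow> K (x \<otimes> g) (y \<otimes> g) = K x y"
    and f: "sum f (carrier G) = 0"
  shows "k * ip (carrier G) (kernel_op (carrier G) K f) (kernel_op (carrier G) K f)
    \<le> (\<Sum>x\<in>carrier G. ip (carrier G) (K x) (K x)) * ip (carrier G) f f"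
proof (cases "ip (carrier G) f f = 0")
  case True
  then have "\<forall>x\<in>carrier G. f x = 0" using fin by (simp add: ip_self_eq_0_iff)
  then have "kernel_op (carrier G) K f = (\<lambda>x. 0)" by (simp add: kernel_op_def fun_eq_iff)
  then show ?thesis using True by (simp add: ip_def)
next
  case False
  let ?ip = "ip (carrier G)" and ?K = "kernel_op (carrier G) K"
  \<comment> \<open>The given \<open>f\<close> serves as the nonzero mean-zero function; the case
    where it vanishes on the group was settled above.\<close>
  obtain l f0 where f0: "sum f0 (carrier G) = 0" "?ip f0 f0 = 1" "defect (carrier G) K l f0 f0 = 0"
    and psd: "\<And>g. sum g (carrier G) = 0 \<Longrightarrow> defect (carrier G) K l g g \<ge> 0"
    by (rule exists_top_value[OF fin False f]) blast
  define W where "W = {g. sum g (carrier G) = 0 \<and> defect (carrier G) K l g g = 0}"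
  have mean_zero_lin: "(\<Sum>x\<in>carrier G. a * g x + b * h x) = 0"
    if "sum g (carrier G) = 0" "sum h (carrier G) = 0" for g h :: "'a \<Rightarrow> real" and a b
    using that unfolding sum.distrib sum_distrib_left[symmetric] by simp
  have lin: "(\<lambda>x. a * g x + b * h x) \<in> W" if "g \<in> W" "h \<in> W" for g h a b
  proof -
    have "defect (carrier G) K l g h = 0"
      by (rule isotropic_orthogonal) (use that psd mean_zero_lin in \<open>auto simp: W_def\<close>)
    then show ?thesis
      using that mean_zero_lin[of g h a b] by (simp add: W_def defect_lincomb_self)
  qed
  have f0W: "f0 \<in> W" using f0 by (simp add: W_def)
  have zero: "(\<lambda>x. 0) \<in> W" using lin[OF f0W f0W, of 0 0] by simp
  \<comment> \<open>Translation commutes with \<open>K\<close> and preserves both \<open>ip\<close>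
    and sums, hence every condition defining \<open>W\<close>.\<close>
  have trans: "(\<lambda>x. h (x \<otimes> g)) \<in> W" if h: "h \<in> W" and g: "g \<in> carrier G" for h g
  proof -
    have "?ip (?K (\<lambda>x. h (x \<otimes> g))) (?K (\<lambda>x. h (x \<otimes> g))) = ?ip (\<lambda>x. ?K h (x \<otimes> g)) (\<lambda>x. ?K h (x \<otimes> g))"
      by (rule ip_cong; rule kernel_op_translate_right[OF _ g]; (rule Kinv)?; assumption)
    then show ?thesis
      using h by (simp add: W_def defect_def ip_translate_right[OF g] sum_translate_right[OF g])
  qed
  obtain d e where on: "orthonormal (carrier G) d e" and eW: "\<And>i. i < d \<Longrightarrow> e i \<in> W"
    and basis: "\<And>h x. h \<in> W \<Longrightarrow> x \<in> carrier G \<Longrightarrow> h x = (\<Sum>j<d. ?ip h (e j) * e j x)"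
    by (rule orthonormal_basis_exists[OF fin, of W]) (use lin zero in blast)+
  have "d > 0"
  proof (rule ccontr)
    assume "\<not> d > 0"
    then have "\<forall>x\<in>carrier G. f0 x = 0" using basis[OF f0W] by simp
    then show False using f0(2) by (simp add: ip_def)
  qed
  have "\<exists>\<rho>. nontrivial_representation G d \<rho>"
  proof (rule nontrivial_representation_of_mean_zero_family[OF on \<open>d > 0\<close>])
    show "sum (e 0) (carrier G) = 0" using eW[OF \<open>d > 0\<close>] by (simp add: W_def)
  qed (rule basis[OF trans[OF eW]])
  with norep have kd: "k \<le> real d" by (meson not_le)
  have "real d * l = (\<Sum>j<d. ?ip (?K (e j)) (?K (e j)))"
  proof -
    have "?ip (?K (e j)) (?K (e j)) = l" if "j < d" for j
      using eW[OF that] on that by (simp add: W_def defect_def orthonormal_def)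
    then show ?thesis by simp
  qed
  \<comment> \<open>The value of \<open>K (e j)\<close> at \<open>x\<close> is the pairing of row
    \<open>K x\<close> with \<open>e j\<close>; after the sums are exchanged, Bessel's inequality
    applies to each row.\<close>
  also have "\<dots> = (\<Sum>j<d. \<Sum>x\<in>carrier G. (?ip (K x) (e j))\<^sup>2)"
    by (simp add: ip_def kernel_op_def power2_eq_square)
  also have "\<dots> = (\<Sum>x\<in>carrier G. \<Sum>j<d. (?ip (K x) (e j))\<^sup>2)"
    by (rule sum.swap)
  also have "\<dots> \<le> (\<Sum>x\<in>carrier G. ?ip (K x) (K x))"
    by (intro sum_mono bessel on)
  finally have dl: "real d * l \<le> (\<Sum>x\<in>carrier G. ?ip (K x) (K x))" .
  have Kf: "?ip (?K f) (?K f) \<le> l * ?ip f f"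
    using psd[OF f] by (simp add: defect_def)
  have "k * ?ip (?K f) (?K f) \<le> real d * ?ip (?K f) (?K f)"
    using kd by (intro mult_right_mono) auto
  also have "\<dots> \<le> real d * (l * ?ip f f)"
    using Kf by (intro mult_left_mono) auto
  also have "\<dots> \<le> (\<Sum>x\<in>carrier G. ?ip (K x) (K x)) * ?ip f f"
    using dl by (simp add: mult_right_mono flip: mult.assoc)
  finally show ?thesis .
qed

section \<open>Counting solutions of \<open>a \<otimes> b = c\<close>\<close>

lemma card_product_triples:
  assumes fin: "finite (carrier G)" and sub: "A \<subseteq> carrier G" "B \<subseteq> carrier G" "C \<subseteq> carrier G"
  shows "real (card {(a, b, c). a \<in> A \<and> b \<in> B \<and> c \<in> C \<and> a \<otimes> b = c})
    = (\<Sum>c\<in>C. \<Sum>b\<in>B. of_bool (c \<otimes> inv b \<in> A))"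
proof -
  have finBC: "finite B" "finite C" using fin sub by (auto intro: finite_subset)
  \<comment> \<open>A solution is determined by \<open>c\<close> and \<open>b\<close>, with
    \<open>a\<close> recovered as \<open>c \<otimes> inv b\<close>.\<close>
  have "card {(a, b, c). a \<in> A \<and> b \<in> B \<and> c \<in> C \<and> a \<otimes> b = c}
      = card {(c, b). c \<in> C \<and> b \<in> B \<and> c \<otimes> inv b \<in> A}"
  proof (rule bij_betw_same_card[of "\<lambda>(a, b, c). (c, b)"],
      rule bij_betw_byWitness[where f' = "\<lambda>(c, b). (c \<otimes> inv b, b, c)"])
    show "\<forall>t\<in>{(a, b, c). a \<in> A \<and> b \<in> B \<and> c \<in> C \<and> a \<otimes> b = c}.
        (\<lambda>(c, b). (c \<otimes> inv b, b, c)) ((\<lambda>(a, b, c). (c, b)) t) = t"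
      using sub by (auto simp: m_assoc subset_iff)
  qed (use sub in \<open>auto simp: m_assoc subset_iff\<close>)
  also have "{(c, b). c \<in> C \<and> b \<in> B \<and> c \<otimes> inv b \<in> A}
      = (SIGMA c:C. {b \<in> B. c \<otimes> inv b \<in> A})" by auto
  also have "real (card \<dots>) = (\<Sum>c\<in>C. real (card {b \<in> B. c \<otimes> inv b \<in> A}))"
    using finBC by (simp add: card_SigmaI)
  also have "\<dots> = (\<Sum>c\<in>C. \<Sum>b\<in>B. of_bool (c \<otimes> inv b \<in> A))"
    using finBC by (simp add: of_bool_def sum.If_cases Int_def)
  finally show ?thesis .
qed

text \<open>The map from \<open>y\<close> to \<open>x \<otimes> inv y\<close> is a bijection onto
  \<open>A\<close>. This makes all row sums of the kernel equal to the size of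
  \<open>A\<close>.\<close>

lemma card_quotient_fibre:
  assumes "A \<subseteq> carrier G" "x \<in> carrier G"
  shows "card {y \<in> carrier G. x \<otimes> inv y \<in> A} = card A"
proof (rule bij_betw_same_card[of "\<lambda>y. x \<otimes> inv y"], rule bij_betw_byWitness[where f' = "\<lambda>a. inv a \<otimes> x"])
  show "\<forall>y\<in>{y \<in> carrier G. x \<otimes> inv y \<in> A}. inv (x \<otimes> inv y) \<otimes> x = y"
    using assms by (auto simp: inv_mult_group m_assoc)
  show "\<forall>a\<in>A. x \<otimes> inv (inv a \<otimes> x) = a"
    using assms by (auto simp: inv_mult_group m_assoc[symmetric] subset_iff)
  show "(\<lambda>a. inv a \<otimes> x) ` A \<subseteq> {y \<in> carrier G. x \<otimes> inv y \<in> A}"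
    using assms by (auto simp: inv_mult_group m_assoc[symmetric] subset_iff)
qed (use assms in auto)

text \<open>The deviation from the expected count is the pairing of the indicator of
  \<open>C\<close> with \<open>K f\<close>, where \<open>f\<close> is the indicator of
  \<open>B\<close> minus its mean. Cauchy-Schwarz contributes the size of \<open>C\<close>, and the
  kernel bound contributes \<open>n * card A * card B / k\<close>.\<close>

lemma product_triples_discrepancy:
  fixes k :: real
  assumes fin: "finite (carrier G)" and "k > 0"
    and norep: "\<not> (\<exists>m \<rho>. real m < k \<and> nontrivial_representation G m \<rho>)"
    and sub: "A \<subseteq> carrier G" "B \<subseteq> carrier G" "C \<subseteq> carrier G"
  defines "n \<equiv> real (card (carrier G))" and "P \<equiv> real (card A) * real (card B) * real (card C)"
  shows "(real (card {(a, b, c). a \<in> A \<and> b \<in> B \<and> c \<in> C \<and> a \<otimes> b = c}) - P / n)\<^sup>2 \<le> n * P / k"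
proof -
  let ?ip = "ip (carrier G)"
  define K where "K x y = (of_bool (x \<otimes> inv y \<in> A) :: real)" for x y
  define f where "f y = of_bool (y \<in> B) - real (card B) / n" for y
  define T where "T = {(a, b, c). a \<in> A \<and> b \<in> B \<and> c \<in> C \<and> a \<otimes> b = c}"
  have n: "n > 0" using fin by (auto simp: n_def card_gt_0_iff)
  have ind: "(\<Sum>x\<in>carrier G. of_bool (x \<in> Y) * h x) = sum h Y" if "Y \<subseteq> carrier G" for Y and h :: "'a \<Rightarrow> real"
    using fin that by (simp add: of_bool_def if_distrib[of "\<lambda>u. u * _"] sum.If_cases Int_absorb1 cong: if_cong)
  have ind1: "(\<Sum>x\<in>carrier G. of_bool (x \<in> Y)) = real (card Y)" if "Y \<subseteq> carrier G" for Y
    using ind[OF that, of "\<lambda>_. 1"] by simp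
  have Kinv: "K (x \<otimes> g) (y \<otimes> g) = K x y" if "x \<in> carrier G" "y \<in> carrier G" "g \<in> carrier G" for x y g
  proof -
    have "(x \<otimes> g) \<otimes> inv (y \<otimes> g) = x \<otimes> ((g \<otimes> inv g) \<otimes> inv y)"
      using that by (simp only: inv_mult_group m_assoc m_closed inv_closed)
    then show ?thesis using that by (simp add: K_def)
  qed
  have Ksum: "sum (K x) (carrier G) = real (card A)" if "x \<in> carrier G" for x
    using card_quotient_fibre[OF sub(1) that] fin
    by (simp add: K_def of_bool_def sum.If_cases Int_def)
  have Krow: "?ip (K x) (K x) = real (card A)" if "x \<in> carrier G" for x
    using Ksum[OF that] by (simp add: ip_def K_def flip: of_bool_conj)
  have fsum: "sum f (carrier G) = 0"
    using n by (simp add: f_def sum_subtractf ind1[OF sub(2)] flip: n_def)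
  have ff: "?ip f f \<le> real (card B)"
  proof -
    \<comment> \<open>As \<open>f\<close> has mean zero, one factor \<open>f\<close> may be replaced
      by the indicator of \<open>B\<close>.\<close>
    have "?ip f f = (\<Sum>x\<in>carrier G. of_bool (x \<in> B) * f x) - (real (card B) / n) * sum f (carrier G)"
      unfolding ip_def sum_distrib_left sum_subtractf[symmetric]
      by (intro sum.cong) (auto simp: f_def algebra_simps)
    also have "\<dots> = sum f B" using fsum ind[OF sub(2)] by simp
    also have "\<dots> = real (card B) * (1 - real (card B) / n)" by (simp add: f_def)
    also have "\<dots> \<le> real (card B) * 1" using n by (intro mult_left_mono) auto
    finally show ?thesis by simp
  qed
  \<comment> \<open>Constant row sums send the subtracted mean of \<open>B\<close> to the constant
    \<open>card A * card B / n\<close>.\<close>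
  have Kf: "kernel_op (carrier G) K f x = (\<Sum>b\<in>B. K x b) - real (card A) * real (card B) / n"
    if "x \<in> carrier G" for x
  proof -
    have "kernel_op (carrier G) K f x
        = (\<Sum>y\<in>carrier G. of_bool (y \<in> B) * K x y) - sum (K x) (carrier G) * (real (card B) / n)"
      unfolding kernel_op_def sum_distrib_right sum_subtractf[symmetric]
      by (intro sum.cong) (auto simp: f_def algebra_simps)
    then show ?thesis by (simp add: ind[OF sub(2)] Ksum[OF that])
  qed
  have "?ip (\<lambda>x. of_bool (x \<in> C)) (kernel_op (carrier G) K f) = (\<Sum>c\<in>C. kernel_op (carrier G) K f c)"
    unfolding ip_def by (rule ind[OF sub(3)])
  also have "\<dots> = (\<Sum>c\<in>C. (\<Sum>b\<in>B. K c b) - real (card A) * real (card B) / n)"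
    using sub by (intro sum.cong Kf) auto
  also have "\<dots> = real (card T) - P / n"
    unfolding T_def card_product_triples[OF fin sub] by (simp add: sum_subtractf K_def P_def)
  finally have "(real (card T) - P / n)\<^sup>2
      = (?ip (\<lambda>x. of_bool (x \<in> C)) (kernel_op (carrier G) K f))\<^sup>2" by simp
  also have "\<dots> \<le> ?ip (\<lambda>x. of_bool (x \<in> C)) (\<lambda>x. of_bool (x \<in> C))
      * ?ip (kernel_op (carrier G) K f) (kernel_op (carrier G) K f)"
    by (rule ip_cauchy_schwarz)
  also have "?ip (\<lambda>x. of_bool (x \<in> C)) (\<lambda>x. of_bool (x \<in> C)) = real (card C)"
    using ind1[OF sub(3)] by (simp add: ip_def flip: of_bool_conj)
  also have "real (card C) * ?ip (kernel_op (carrier G) K f) (kernel_op (carrier G) K f)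
      \<le> real (card C) * (n * real (card A) * real (card B) / k)"
  proof (intro mult_left_mono)
    have "k * ?ip (kernel_op (carrier G) K f) (kernel_op (carrier G) K f)
        \<le> (\<Sum>x\<in>carrier G. ?ip (K x) (K x)) * ?ip f f"
      by (rule invariant_kernel_bound[OF fin norep _ fsum]) (rule Kinv)
    also have "\<dots> = n * real (card A) * ?ip f f"
      by (simp add: Krow n_def)
    also have "\<dots> \<le> n * real (card A) * real (card B)"
      using ff n by (intro mult_left_mono) auto
    finally show "?ip (kernel_op (carrier G) K f) (kernel_op (carrier G) K f)
        \<le> n * real (card A) * real (card B) / k"
      using \<open>k > 0\<close> by (simp add: field_simps)
  qed simp
  also have "\<dots> = n * P / k" by (simp add: P_def)
  finally show ?thesis by (simp add: T_def)
qed

end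

theorem theorem3p3:
  fixes G :: "('a, 'b) monoid_scheme" and k :: real and n :: nat
  assumes "group G" and "finite (carrier G)"
    and "k > 0"
    and "\<not> (\<exists>m \<rho>. real m < k \<and> nontrivial_representation G m \<rho>)"
    and "n = card (carrier G)"
  shows "(\<forall>A B C. A \<subseteq> carrier G \<longrightarrow> B \<subseteq> carrier G \<longrightarrow> C \<subseteq> carrier G \<longrightarrow>
            real (card A) * real (card B) * real (card C) > real n ^ 3 / k \<longrightarrow>
            (\<exists>a\<in>A. \<exists>b\<in>B. \<exists>c\<in>C. a \<otimes>\<^bsub>G\<^esub> b = c)) \<and>
         (\<forall>A B C. A \<subseteq> carrier G \<longrightarrow> B \<subseteq> carrier G \<longrightarrow> C \<subseteq> carrier G \<longrightarrow>
            real (card A) > real n / k powr (1 / 3) \<longrightarrow>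
            real (card B) > real n / k powr (1 / 3) \<longrightarrow>
            real (card C) > real n / k powr (1 / 3) \<longrightarrow>
            (\<exists>a\<in>A. \<exists>b\<in>B. \<exists>c\<in>C. a \<otimes>\<^bsub>G\<^esub> b = c)) \<and>
         (\<forall>(\<eta>::real) A B C. \<eta> > 0 \<longrightarrow>
            A \<subseteq> carrier G \<longrightarrow> B \<subseteq> carrier G \<longrightarrow> C \<subseteq> carrier G \<longrightarrow>
            real (card A) * real (card B) * real (card C) \<ge> real n ^ 3 / (\<eta>\<^sup>2 * k) \<longrightarrow>
            real (card {(a, b, c). a \<in> A \<and> b \<in> B \<and> c \<in> C \<and> a \<otimes>\<^bsub>G\<^esub> b = c})
              \<ge> (1 - \<eta>) * real (card A) * real (card B) * real (card C) / real n)"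
proof -
  interpret group G by fact
  have n: "real n > 0" using assms(2,5) by (auto simp: card_gt_0_iff)
  \<comment> \<open>All three claims are read off from this bound; the second reduces to the
    first.\<close>
  note disc = product_triples_discrepancy[OF assms(2-4), folded assms(5)]
  have 1: "\<exists>a\<in>A. \<exists>b\<in>B. \<exists>c\<in>C. a \<otimes>\<^bsub>G\<^esub> b = c"
    if sub: "A \<subseteq> carrier G" "B \<subseteq> carrier G" "C \<subseteq> carrier G"
      and big: "real (card A) * real (card B) * real (card C) > real n ^ 3 / k" for A B C
  proof (rule ccontr)
    let ?P = "real (card A) * real (card B) * real (card C)"
    assume "\<not> ?thesis"
    then have "{(a, b, c). a \<in> A \<and> b \<in> B \<and> c \<in> C \<and> a \<otimes>\<^bsub>G\<^esub> b = c} = {}" by auto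
    then have "(0 - ?P / real n)\<^sup>2 \<le> real n * ?P / k"
      using disc[OF sub] by (simp only: card.empty of_nat_0)
    \<comment> \<open>With no solutions the deviation is the whole main term; cancelling one
      positive factor \<open>?P\<close> contradicts \<open>big\<close>.\<close>
    then have "?P * ?P \<le> ?P * (real n ^ 3 / k)"
      using n \<open>k > 0\<close> by (simp add: field_simps power2_eq_square power3_eq_cube)
    moreover have "?P > 0"
      using big n \<open>k > 0\<close> by (smt (verit) divide_pos_pos zero_less_power)
    ultimately show False using big by (meson mult_le_cancel_left_pos not_le)
  qed
  have 2: "\<exists>a\<in>A. \<exists>b\<in>B. \<exists>c\<in>C. a \<otimes>\<^bsub>G\<^esub> b = c"
    if sub: "A \<subseteq> carrier G" "B \<subseteq> carrier G" "C \<subseteq> carrier G"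
      and big: "real (card A) > real n / k powr (1 / 3)" "real (card B) > real n / k powr (1 / 3)"
        "real (card C) > real n / k powr (1 / 3)" for A B C
  proof (rule 1[OF sub])
    let ?q = "real n / k powr (1 / 3)"
    have q: "?q > 0" using n \<open>k > 0\<close> by simp
    have "(k powr (1 / 3)) ^ 3 = k"
      using \<open>k > 0\<close> by (simp add: powr_powr flip: powr_numeral)
    then have "real n ^ 3 / k = ?q * ?q * ?q"
      by (simp add: power_divide power3_eq_cube)
    also have "\<dots> < real (card A) * real (card B) * real (card C)"
      using q big by (intro mult_strict_mono) auto
    finally show "real n ^ 3 / k < real (card A) * real (card B) * real (card C)" .
  qed
  have 3: "real (card {(a, b, c). a \<in> A \<and> b \<in> B \<and> c \<in> C \<and> a \<otimes>\<^bsub>G\<^esub> b = c})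
      \<ge> (1 - \<eta>) * real (card A) * real (card B) * real (card C) / real n"
    if \<eta>: "\<eta> > 0" and sub: "A \<subseteq> carrier G" "B \<subseteq> carrier G" "C \<subseteq> carrier G"
      and big: "real (card A) * real (card B) * real (card C) \<ge> real n ^ 3 / (\<eta>\<^sup>2 * k)" for \<eta> A B C
  proof -
    define P where "P = real (card A) * real (card B) * real (card C)"
    define N where "N = real (card {(a, b, c). a \<in> A \<and> b \<in> B \<and> c \<in> C \<and> a \<otimes>\<^bsub>G\<^esub> b = c})"
    have P: "P \<ge> 0" by (simp add: P_def)
    have "(N - P / real n)\<^sup>2 \<le> real n * P / k"
      using disc[OF sub] by (simp add: N_def P_def)
    \<comment> \<open>This isolates the threshold \<open>real n ^ 3 / (\<eta>\<^sup>2 * k)\<close>,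
      which \<open>big\<close> then replaces by \<open>P\<close>, leaving a perfect square.\<close>
    also have "\<dots> = (\<eta>\<^sup>2 / (real n)\<^sup>2) * (P * (real n ^ 3 / (\<eta>\<^sup>2 * k)))"
      using n \<eta> \<open>k > 0\<close> by (simp add: field_simps power2_eq_square power3_eq_cube)
    also have "\<dots> \<le> (\<eta>\<^sup>2 / (real n)\<^sup>2) * (P * P)"
      using big P by (intro mult_left_mono) (auto simp: P_def)
    also have "\<dots> = (\<eta> * P / real n)\<^sup>2"
      by (simp add: power2_eq_square)
    finally have "\<bar>N - P / real n\<bar> \<le> \<eta> * P / real n"
      using \<eta> P by (subst (asm) abs_le_square_iff[symmetric]) simp
    then have "N \<ge> (1 - \<eta>) * P / real n"
      by (simp add: algebra_simps diff_divide_distrib)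
    then show ?thesis by (simp add: N_def P_def mult.assoc)
  qed
  show ?thesis
    by (intro conjI allI impI) (rule 1 2 3; assumption)+
qed

end
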